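(* For any first-order standpoint logic formula $\phi$, one can compute in polynomial time a nullary-free first-order standpoint logic formula $\mathsf{NF}(\phi)$ equisatisfiable with $\phi$. Moreover, if $\phi$ is $\mathcal{C}^2$ (resp. S5, resp. monodic) then so is $\mathsf{NF}(\phi)$.
   Context: FOSL: signature $\langle\mathbf{P},\mathbf{C},\mathbf{S}\rangle$ (predicates with arities in $\mathbb{N}$, possibly $0$; constants; standpoint symbols including $*$). Standpoint expressions $e ::= s\mid e_1\cap e_2\mid e_1\cup e_2\mid e_1\setminus e_2$. Formulae $\phi ::= P(t_1,\dots,t_k)\mid t_1\doteq t_2\mid\neg\phi\mid\phi\wedge\psi\mid\exists^{\lhd n}x.\phi\mid\Diamond_e\phi$ with $\lhd\in\{\le,=,\ge\}$. Standpoint structure $\langle\Delta,\Pi,\sigma,\gamma\rangle$: nonempty domain, nonempty precisification set $\Pi$, $\sigma( * )=\Pi$, $\sigma$ extended set-theoretically, $\gamma(\pi)$ a first-order structure over $\Delta$ with rigid constants; $\Diamond_e\phi$ holds at $\pi$ iff $\phi$ holds at some $\pi'\in\sigma(e)$ under the same assignment; quantifier counts are evaluated in the current precisification; a model satisfies the formula at all precisifications under all assignments. Equisatisfiable: one satisfiable iff the other is. Nullary-free: no predicates of arity $0$ used. S5: only standpoint expression $*$ used. $\mathcal{C}^2$: only variables $x,y$ and predicates of arity at most 2. Monodic: in every subformula $\Diamond_e\psi$, $\psi$ has at most one free variable. *)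

theory Defs
  imports "HOL-Library.Countable_Set" "HOL-Computational_Algebra.Polynomial"
begin

section \<open>First-order standpoint logic\<close>

subsection \<open>Syntax\<close>

text \<open>
  The vocabulary provides countably many variables, constants, standpoint symbols other
  than the universal one, and countably many predicate symbols of each arity. A predicate
  symbol is a pair \<open>(p, k)\<close> of a name and an arity, so equal names at different arities are
  different symbols. The atom \<open>Pred p ts\<close> uses the symbol \<open>(p, length ts)\<close>.
\<close>

datatype trm = Var nat | Const nat

datatype stsym = Star | St nat

datatype stexp = Sym stsym | Cap stexp stexp | Cup stexp stexp | Minus stexp stexp

datatype cmp = AtMost | Exactly | AtLeast

datatype fmla =
    Pred nat "trm list"
  | Eq trm trm
  | Neg fmla
  | Conj fmla fmla
  | Count cmp nat nat fmla  \<comment> \<open>\<open>Count \<lhd> n x \<phi>\<close> is the quantifier \<open>\<exists>\<close> with superscript \<open>\<lhd> n\<close>, binding \<open>x\<close>\<close>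
  | Dia stexp fmla

primrec trm_vars :: "trm \<Rightarrow> nat set" where
  "trm_vars (Var x) = {x}"
| "trm_vars (Const c) = {}"

text \<open>All variables occurring in a formula, including those that occur only in a quantifier.\<close>

primrec vars :: "fmla \<Rightarrow> nat set" where
  "vars (Pred p ts) = (\<Union>t\<in>set ts. trm_vars t)"
| "vars (Eq s t) = trm_vars s \<union> trm_vars t"
| "vars (Neg \<phi>) = vars \<phi>"
| "vars (Conj \<phi> \<psi>) = vars \<phi> \<union> vars \<psi>"
| "vars (Count c n x \<phi>) = insert x (vars \<phi>)"
| "vars (Dia e \<phi>) = vars \<phi>"

primrec fv :: "fmla \<Rightarrow> nat set" where
  "fv (Pred p ts) = (\<Union>t\<in>set ts. trm_vars t)"
| "fv (Eq s t) = trm_vars s \<union> trm_vars t"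
| "fv (Neg \<phi>) = fv \<phi>"
| "fv (Conj \<phi> \<psi>) = fv \<phi> \<union> fv \<psi>"
| "fv (Count c n x \<phi>) = fv \<phi> - {x}"
| "fv (Dia e \<phi>) = fv \<phi>"

primrec preds :: "fmla \<Rightarrow> (nat \<times> nat) set" where
  "preds (Pred p ts) = {(p, length ts)}"
| "preds (Eq s t) = {}"
| "preds (Neg \<phi>) = preds \<phi>"
| "preds (Conj \<phi> \<psi>) = preds \<phi> \<union> preds \<psi>"
| "preds (Count c n x \<phi>) = preds \<phi>"
| "preds (Dia e \<phi>) = preds \<phi>"

primrec subfmlas :: "fmla \<Rightarrow> fmla set" where
  "subfmlas (Pred p ts) = {Pred p ts}"
| "subfmlas (Eq s t) = {Eq s t}"
| "subfmlas (Neg \<phi>) = insert (Neg \<phi>) (subfmlas \<phi>)"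
| "subfmlas (Conj \<phi> \<psi>) = insert (Conj \<phi> \<psi>) (subfmlas \<phi> \<union> subfmlas \<psi>)"
| "subfmlas (Count c n x \<phi>) = insert (Count c n x \<phi>) (subfmlas \<phi>)"
| "subfmlas (Dia e \<phi>) = insert (Dia e \<phi>) (subfmlas \<phi>)"

definition nullary_free :: "fmla \<Rightarrow> bool" where
  "nullary_free \<phi> \<longleftrightarrow> (\<forall>(p, k)\<in>preds \<phi>. k \<noteq> 0)"

definition is_S5 :: "fmla \<Rightarrow> bool" where
  "is_S5 \<phi> \<longleftrightarrow> (\<forall>e \<psi>. Dia e \<psi> \<in> subfmlas \<phi> \<longrightarrow> e = Sym Star)"

text \<open>The two variables of the two-variable fragment are fixed: \<open>x\<close> is \<open>0\<close> and \<open>y\<close> is \<open>1\<close>.\<close>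

definition is_C2 :: "fmla \<Rightarrow> bool" where
  "is_C2 \<phi> \<longleftrightarrow> vars \<phi> \<subseteq> {0, 1} \<and> (\<forall>(p, k)\<in>preds \<phi>. k \<le> 2)"

definition monodic :: "fmla \<Rightarrow> bool" where
  "monodic \<phi> \<longleftrightarrow> (\<forall>e \<psi>. Dia e \<psi> \<in> subfmlas \<phi> \<longrightarrow> card (fv \<psi>) \<le> 1)"


subsection \<open>Semantics\<close>

record 'd fo_struct =
  pred_int :: "nat \<times> nat \<Rightarrow> 'd list set"
  const_int :: "nat \<Rightarrow> 'd"

record ('d, 'p) st_struct =
  domain :: "'d set"
  precs :: "'p set"
  sigma :: "stsym \<Rightarrow> 'p set"
  gam :: "'p \<Rightarrow> 'd fo_struct"

definition standpoint_structure :: "('d, 'p) st_struct \<Rightarrow> bool" where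
  "standpoint_structure M \<longleftrightarrow>
     domain M \<noteq> {} \<and> precs M \<noteq> {} \<and>
     (\<forall>s. sigma M s \<subseteq> precs M) \<and> sigma M Star = precs M \<and>
     (\<forall>\<pi>\<in>precs M. \<forall>p k. pred_int (gam M \<pi>) (p, k) \<subseteq> {ds. length ds = k \<and> set ds \<subseteq> domain M}) \<and>
     (\<forall>\<pi>\<in>precs M. \<forall>c. const_int (gam M \<pi>) c \<in> domain M) \<and>
     (\<forall>\<pi>\<in>precs M. \<forall>\<pi>'\<in>precs M. \<forall>c. const_int (gam M \<pi>) c = const_int (gam M \<pi>') c)"

primrec st_val :: "('d, 'p) st_struct \<Rightarrow> stexp \<Rightarrow> 'p set" where
  "st_val M (Sym s) = sigma M s"
| "st_val M (Cap e f) = st_val M e \<inter> st_val M f"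
| "st_val M (Cup e f) = st_val M e \<union> st_val M f"
| "st_val M (Minus e f) = st_val M e - st_val M f"

primrec trm_val :: "'d fo_struct \<Rightarrow> (nat \<Rightarrow> 'd) \<Rightarrow> trm \<Rightarrow> 'd" where
  "trm_val I v (Var x) = v x"
| "trm_val I v (Const c) = const_int I c"

text \<open>Infinite sets have \<open>card\<close> zero, so they are treated separately.\<close>

primrec count_holds :: "cmp \<Rightarrow> 'a set \<Rightarrow> nat \<Rightarrow> bool" where
  "count_holds AtMost A n \<longleftrightarrow> finite A \<and> card A \<le> n"
| "count_holds Exactly A n \<longleftrightarrow> finite A \<and> card A = n"
| "count_holds AtLeast A n \<longleftrightarrow> infinite A \<or> card A \<ge> n"

primrec holds :: "('d, 'p) st_struct \<Rightarrow> fmla \<Rightarrow> 'p \<Rightarrow> (nat \<Rightarrow> 'd) \<Rightarrow> bool" where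
  "holds M (Pred p ts) \<pi> v \<longleftrightarrow> map (trm_val (gam M \<pi>) v) ts \<in> pred_int (gam M \<pi>) (p, length ts)"
| "holds M (Eq s t) \<pi> v \<longleftrightarrow> trm_val (gam M \<pi>) v s = trm_val (gam M \<pi>) v t"
| "holds M (Neg \<phi>) \<pi> v \<longleftrightarrow> \<not> holds M \<phi> \<pi> v"
| "holds M (Conj \<phi> \<psi>) \<pi> v \<longleftrightarrow> holds M \<phi> \<pi> v \<and> holds M \<psi> \<pi> v"
| "holds M (Count c n x \<phi>) \<pi> v \<longleftrightarrow> count_holds c {d \<in> domain M. holds M \<phi> \<pi> (v(x := d))} n"
| "holds M (Dia e \<phi>) \<pi> v \<longleftrightarrow> (\<exists>\<pi>'\<in>st_val M e. holds M \<phi> \<pi>' v)"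

definition is_model :: "('d, 'p) st_struct \<Rightarrow> fmla \<Rightarrow> bool" where
  "is_model M \<phi> \<longleftrightarrow> standpoint_structure M \<and>
     (\<forall>\<pi>\<in>precs M. \<forall>v. range v \<subseteq> domain M \<longrightarrow> holds M \<phi> \<pi> v)"

text \<open>
  A formula of HOL cannot quantify over the types of domain elements and precisifications,
  so the definition draws both from \<open>nat\<close>. This excludes nothing: by the
  Loewenheim-Skolem argument below (lemma \<open>satisfiableI\<close>), a formula with a model over any
  two types has a model over \<open>nat\<close>.
\<close>

definition satisfiable :: "fmla \<Rightarrow> bool" where
  "satisfiable \<phi> \<longleftrightarrow> (\<exists>M :: (nat, nat) st_struct. is_model M \<phi>)"

definition equisatisfiable :: "fmla \<Rightarrow> fmla \<Rightarrow> bool" where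
  "equisatisfiable \<phi> \<psi> \<longleftrightarrow> (satisfiable \<phi> \<longleftrightarrow> satisfiable \<psi>)"


subsection \<open>Satisfiability does not depend on the types of the model\<close>

instance trm :: countable by countable_datatype
instance stsym :: countable by countable_datatype
instance stexp :: countable by countable_datatype
instance cmp :: countable by countable_datatype
instance fmla :: countable by countable_datatype

lemma finite_trm_vars [simp]: "finite (trm_vars t)"
  by (cases t) auto

lemma finite_fv [simp]: "finite (fv \<phi>)"
  by (induction \<phi>) auto

lemma trm_val_cong: "(\<And>x. x \<in> trm_vars t \<Longrightarrow> v x = w x) \<Longrightarrow> trm_val I v t = trm_val I w t"
  by (cases t) auto

lemma holds_cong:
  "(\<And>x. x \<in> fv \<phi> \<Longrightarrow> v x = w x) \<Longrightarrow> holds M \<phi> \<pi> v = holds M \<phi> \<pi> w"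
proof (induction \<phi> arbitrary: \<pi> v w)
  case (Pred p ts)
  then have "map (trm_val (gam M \<pi>) v) ts = map (trm_val (gam M \<pi>) w) ts"
    by (auto intro!: trm_val_cong)
  then show ?case by (simp only: holds.simps)
next
  case (Eq s t)
  then have "trm_val (gam M \<pi>) v s = trm_val (gam M \<pi>) w s"
    "trm_val (gam M \<pi>) v t = trm_val (gam M \<pi>) w t"
    by (auto intro!: trm_val_cong)
  then show ?case by (simp only: holds.simps)
next
  case (Neg \<phi>)
  then show ?case by (metis fv.simps(3) holds.simps(3))
next
  case (Conj \<phi> \<psi>)
  then show ?case by (metis UnI1 UnI2 fv.simps(4) holds.simps(4))
next
  case (Count c n x \<phi>)
  have "holds M \<phi> \<pi> (v(x := d)) = holds M \<phi> \<pi> (w(x := d))" for d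
    by (rule Count.IH) (use Count.prems in auto)
  then show ?case by simp
next
  case (Dia e \<phi>)
  have "holds M \<phi> \<pi>' v = holds M \<phi> \<pi>' w" for \<pi>'
    by (rule Dia.IH) (use Dia.prems in auto)
  then show ?case by simp
qed

lemma standpoint_structureD:
  assumes "standpoint_structure M"
  shows "domain M \<noteq> {}" "precs M \<noteq> {}" "sigma M s \<subseteq> precs M" "sigma M Star = precs M"
    "\<pi> \<in> precs M \<Longrightarrow>
      pred_int (gam M \<pi>) (p, k) \<subseteq> {ds. length ds = k \<and> set ds \<subseteq> domain M}"
    "\<pi> \<in> precs M \<Longrightarrow> const_int (gam M \<pi>) c \<in> domain M"
    "\<pi> \<in> precs M \<Longrightarrow> \<pi>' \<in> precs M \<Longrightarrow>
      const_int (gam M \<pi>) c = const_int (gam M \<pi>') c"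
  using assms unfolding standpoint_structure_def by blast+

lemma st_val_subset: "standpoint_structure M \<Longrightarrow> st_val M e \<subseteq> precs M"
  by (induction e) (use standpoint_structureD(3) in auto)

lemma count_holds_image: "inj_on f A \<Longrightarrow> count_holds c (f ` A) n = count_holds c A n"
  by (cases c) (auto simp: card_image finite_image_iff)

text \<open>Renaming the elements and precisifications of a structure injectively.\<close>

lemma satisfiable_countable:
  fixes M :: "('d, 'p) st_struct"
  assumes M: "is_model M \<phi>" and cD: "countable (domain M)" and cP: "countable (precs M)"
  shows "satisfiable \<phi>"
proof -
  define f where "f = to_nat_on (domain M)"
  define g where "g = to_nat_on (precs M)"
  have injf: "inj_on f (domain M)" and injg: "inj_on g (precs M)"
    using cD cP by (simp_all add: f_def g_def inj_on_to_nat_on)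
  define g' where "g' = inv_into (precs M) g"
  have g'g: "g' (g \<pi>) = \<pi>" if "\<pi> \<in> precs M" for \<pi>
    using that injg by (simp add: g'_def)
  define N :: "(nat, nat) st_struct" where
    "N = \<lparr>domain = f ` domain M, precs = g ` precs M, sigma = (\<lambda>s. g ` sigma M s),
          gam = (\<lambda>q. \<lparr>pred_int = (\<lambda>P. map f ` pred_int (gam M (g' q)) P),
                       const_int = (\<lambda>c. f (const_int (gam M (g' q)) c))\<rparr>)\<rparr>"
  have stM: "standpoint_structure M" using M by (simp add: is_model_def)
  have stN: "standpoint_structure N"
  proof -
    have "domain N \<noteq> {}" "precs N \<noteq> {}" "\<forall>s. sigma N s \<subseteq> precs N" "sigma N Star = precs N"
      using standpoint_structureD(1-4)[OF stM] by (auto simp: N_def)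
    moreover have "pred_int (gam N q) (p, k) \<subseteq> {ds. length ds = k \<and> set ds \<subseteq> domain N}"
      if q: "q \<in> precs N" for q p k
    proof -
      obtain \<pi> where \<pi>: "\<pi> \<in> precs M" "q = g \<pi>" using q by (auto simp: N_def)
      have eqs: "pred_int (gam N q) (p, k) = map f ` pred_int (gam M \<pi>) (p, k)"
        "domain N = f ` domain M"
        using \<pi> by (simp_all add: N_def g'g)
      show ?thesis
      proof
        fix es assume "es \<in> pred_int (gam N q) (p, k)"
        then obtain ds where "es = map f ds" "ds \<in> pred_int (gam M \<pi>) (p, k)"
          unfolding eqs by blast
        moreover from this have "length ds = k" "set ds \<subseteq> domain M"
          using standpoint_structureD(5)[OF stM \<pi>(1)] by blast+
        ultimately show "es \<in> {es. length es = k \<and> set es \<subseteq> domain N}"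
          unfolding eqs by (simp add: image_mono)
      qed
    qed
    moreover have "const_int (gam N q) c \<in> domain N" if "q \<in> precs N" for q c
      using that standpoint_structureD(6)[OF stM] by (auto simp: N_def g'g)
    moreover have "const_int (gam N q) c = const_int (gam N q') c"
      if q: "q \<in> precs N" "q' \<in> precs N" for q q' c
    proof -
      obtain \<pi> \<pi>' where \<pi>: "\<pi> \<in> precs M" "q = g \<pi>" "\<pi>' \<in> precs M" "q' = g \<pi>'"
        using q by (auto simp: N_def)
      then have "const_int (gam M \<pi>) c = const_int (gam M \<pi>') c"
        using standpoint_structureD(7)[OF stM] by blast
      then show ?thesis using \<pi> by (simp add: N_def g'g)
    qed
    ultimately show ?thesis unfolding standpoint_structure_def by blast
  qed
  have val: "st_val N e = g ` st_val M e" for e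
  proof (induction e)
    case (Sym s)
    then show ?case by (simp add: N_def)
  next
    case (Cap e e')
    then show ?case using inj_on_image_Int[OF injg st_val_subset[OF stM] st_val_subset[OF stM]]
      by simp
  next
    case (Cup e e')
    then show ?case by (simp add: image_Un)
  next
    case (Minus e e')
    have "st_val M e - st_val M e' \<subseteq> precs M" using st_val_subset[OF stM] by blast
    then show ?case using Minus inj_on_image_set_diff[OF injg _ st_val_subset[OF stM]]
      by simp
  qed
  have trm: "trm_val (gam N (g \<pi>)) (f \<circ> v) t = f (trm_val (gam M \<pi>) v t)"
    if "\<pi> \<in> precs M" for \<pi> v t
    using that by (cases t) (simp_all add: N_def g'g)
  have in_dom: "trm_val (gam M \<pi>) v t \<in> domain M" if "\<pi> \<in> precs M" "range v \<subseteq> domain M" for \<pi> v t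
    using that standpoint_structureD(6)[OF stM] by (cases t) auto
  have iso: "holds N \<psi> (g \<pi>) (f \<circ> v) = holds M \<psi> \<pi> v"
    if "\<pi> \<in> precs M" "range v \<subseteq> domain M" for \<psi> \<pi> v
    using that
  proof (induction \<psi> arbitrary: \<pi> v)
    case (Pred p ts)
    let ?l = "map (trm_val (gam M \<pi>) v) ts"
    let ?R = "pred_int (gam M \<pi>) (p, length ts)"
    have l: "set ?l \<subseteq> domain M" using in_dom[OF Pred] by auto
    have R: "set ds \<subseteq> domain M" if "ds \<in> ?R" for ds
      using standpoint_structureD(5)[OF stM Pred(1)] that by blast
    have "map f ?l \<in> map f ` ?R \<longleftrightarrow> ?l \<in> ?R"
    proof
      assume "map f ?l \<in> map f ` ?R"
      then obtain ds where ds: "ds \<in> ?R" "map f ?l = map f ds" by blast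
      have "inj_on f (set ?l \<union> set ds)"
        using l R[OF ds(1)] by (intro inj_on_subset[OF injf]) blast
      then have "?l = ds" using ds(2) map_inj_on by blast
      then show "?l \<in> ?R" using ds(1) by simp
    qed blast
    moreover have "map (trm_val (gam N (g \<pi>)) (f \<circ> v)) ts = map f ?l"
      using trm[OF Pred(1)] by simp
    moreover have "pred_int (gam N (g \<pi>)) (p, length ts) = map f ` ?R"
      using Pred(1) by (simp add: N_def g'g)
    ultimately show ?case by (simp only: holds.simps)
  next
    case (Eq s t)
    then show ?case using trm[OF Eq(1)] in_dom[OF Eq] injf
      unfolding holds.simps by (metis inj_onD)
  next
    case (Count c n x \<psi>)
    have upd: "(f \<circ> v)(x := f d) = f \<circ> v(x := d)" for d by auto
    have ih: "holds N \<psi> (g \<pi>) ((f \<circ> v)(x := f d)) = holds M \<psi> \<pi> (v(x := d))"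
      if "d \<in> domain M" for d
      unfolding upd by (rule Count.IH) (use Count.prems that in auto)
    have "{d \<in> domain N. holds N \<psi> (g \<pi>) ((f \<circ> v)(x := d))}
        = f ` {d \<in> domain M. holds M \<psi> \<pi> (v(x := d))}"
      using ih by (auto simp: N_def)
    moreover have "inj_on f {d \<in> domain M. holds M \<psi> \<pi> (v(x := d))}"
      by (rule inj_on_subset[OF injf]) blast
    ultimately show ?case by (simp only: holds.simps count_holds_image)
  next
    case (Dia e \<psi>)
    have "holds N \<psi> (g \<pi>') (f \<circ> v) = holds M \<psi> \<pi>' v" if "\<pi>' \<in> st_val M e" for \<pi>'
      using Dia that st_val_subset[OF stM] by blast
    then show ?case unfolding holds.simps val by blast
  qed auto
  have "holds N \<phi> q w" if q: "q \<in> precs N" and w: "range w \<subseteq> domain N" for q w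
  proof -
    obtain \<pi> where \<pi>: "\<pi> \<in> precs M" "q = g \<pi>" using q by (auto simp: N_def)
    define v where "v = inv_into (domain M) f \<circ> w"
    have "w x \<in> f ` domain M" for x using w by (auto simp: N_def)
    then have "w = f \<circ> v" "range v \<subseteq> domain M"
      by (auto simp: v_def fun_eq_iff f_inv_into_f inv_into_into)
    then show ?thesis using iso[OF \<pi>(1)] \<pi> M by (simp add: is_model_def)
  qed
  then have "is_model N \<phi>" using stN by (simp add: is_model_def)
  then show ?thesis unfolding satisfiable_def by blast
qed

text \<open>
  Downward Loewenheim-Skolem: close a countable set of elements and precisifications under
  witnesses. For a counting quantifier, all elements satisfying the body are added if there
  are finitely many, and a countably infinite subset of them otherwise.
\<close>

lemma satisfiableI:
  fixes M :: "('d, 'p) st_struct"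
  assumes M: "is_model M \<phi>"
  shows "satisfiable \<phi>"
proof -
  have stM: "standpoint_structure M" using M by (simp add: is_model_def)
  then obtain d0 \<pi>0 where d0: "d0 \<in> domain M" and \<pi>0: "\<pi>0 \<in> precs M"
    using standpoint_structureD(1,2) by blast
  have const_dom: "const_int (gam M \<pi>) c \<in> domain M" if "\<pi> \<in> precs M" for \<pi> c
    using standpoint_structureD(6)[OF stM that] .
  have rigid: "const_int (gam M \<pi>) c = const_int (gam M \<pi>0) c" if "\<pi> \<in> precs M" for \<pi> c
    using standpoint_structureD(7)[OF stM that \<pi>0] .
  define asg where "asg l = (\<lambda>x. if x < length l then l ! x else d0)" for l :: "'d list"
  let ?A = "\<lambda>\<psi> x \<pi> v. {d \<in> domain M. holds M \<psi> \<pi> (v(x := d))}"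
  have "\<exists>W. W \<subseteq> A \<and> countable W \<and> (finite A \<longrightarrow> W = A) \<and> (infinite A \<longrightarrow> infinite W)"
    for A :: "'d set"
    using infinite_countable_subset'[of A] countable_finite by (cases "finite A") blast+
  then obtain W :: "'d set \<Rightarrow> 'd set" where W: "\<And>A. W A \<subseteq> A" "\<And>A. countable (W A)"
    "\<And>A. finite A \<Longrightarrow> W A = A" "\<And>A. infinite A \<Longrightarrow> infinite (W A)"
    by metis
  define V where "V e \<psi> v = (if \<exists>\<pi>\<in>st_val M e. holds M \<psi> \<pi> v
      then {SOME \<pi>. \<pi> \<in> st_val M e \<and> holds M \<psi> \<pi> v} else {})" for e \<psi> v
  have V: "V e \<psi> v \<subseteq> {\<pi> \<in> st_val M e. holds M \<psi> \<pi> v}" "countable (V e \<psi> v)"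
    "\<exists>\<pi>\<in>st_val M e. holds M \<psi> \<pi> v \<Longrightarrow> V e \<psi> v \<noteq> {}" for e \<psi> v
    unfolding V_def by (auto intro: someI2)
  define stepD where "stepD D P = D \<union>
      (\<Union>\<psi>. \<Union>x. \<Union>\<pi>\<in>P. \<Union>l\<in>lists D. W (?A \<psi> x \<pi> (asg l)))" for D P
  define stepP where "stepP D P = P \<union> (\<Union>e. \<Union>\<psi>. \<Union>l\<in>lists D. V e \<psi> (asg l))" for D P
  define Q where "Q = rec_nat (insert d0 (range (const_int (gam M \<pi>0))), {\<pi>0})
      (\<lambda>_ (D, P). (stepD D P, stepP D P))"
  define D where "D n = fst (Q n)" for n
  define P where "P n = snd (Q n)" for n
  have D_0: "D 0 = insert d0 (range (const_int (gam M \<pi>0)))" and P_0: "P 0 = {\<pi>0}"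
    by (simp_all add: D_def P_def Q_def)
  have D_Suc: "D (Suc n) = stepD (D n) (P n)" and P_Suc: "P (Suc n) = stepP (D n) (P n)" for n
    by (simp_all add: D_def P_def Q_def split: prod.split)
  have cnt: "countable (D n) \<and> countable (P n)" for n
  proof (induction n)
    case 0
    then show ?case by (simp add: D_0 P_0)
  next
    case (Suc n)
    then have "countable (stepD (D n) (P n))" "countable (stepP (D n) (P n))"
      unfolding stepD_def stepP_def using W(2) V(2)
      by (intro countable_Un countable_UN countable_lists; simp)+
    then show ?case by (simp add: D_Suc P_Suc)
  qed
  have sub: "D n \<subseteq> domain M \<and> P n \<subseteq> precs M" for n
  proof (induction n)
    case 0
    then show ?case using d0 \<pi>0 const_dom by (auto simp: D_0 P_0)
  next
    case (Suc n)
    moreover have "W (?A \<psi> x \<pi> v) \<subseteq> domain M" for \<psi> x \<pi> v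
      using W(1)[of "?A \<psi> x \<pi> v"] by blast
    moreover have "V e \<psi> v \<subseteq> precs M" for e \<psi> v
      using V(1)[of e \<psi> v] st_val_subset[OF stM] by blast
    ultimately show ?case unfolding D_Suc P_Suc stepD_def stepP_def by blast
  qed
  have "D n \<subseteq> D (Suc n)" "P n \<subseteq> P (Suc n)" for n
    unfolding D_Suc P_Suc stepD_def stepP_def by blast+
  then have mono: "D m \<subseteq> D n" "P m \<subseteq> P n" if "m \<le> n" for m n
    using lift_Suc_mono_le[of D, OF _ that] lift_Suc_mono_le[of P, OF _ that] by simp_all
  define D' where "D' = (\<Union>n. D n)"
  define P' where "P' = (\<Union>n. P n)"
  have D'M: "D' \<subseteq> domain M" and P'M: "P' \<subseteq> precs M" using sub by (auto simp: D'_def P'_def)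
  have cD': "countable D'" and cP': "countable P'" using cnt by (auto simp: D'_def P'_def)
  have d0': "d0 \<in> D'" and \<pi>0': "\<pi>0 \<in> P'"
    using D_0 P_0 unfolding D'_def P'_def by blast+
  have const': "const_int (gam M \<pi>) c \<in> D'" if "\<pi> \<in> P'" for \<pi> c
    using rigid[of \<pi> c] that P'M D_0 unfolding D'_def by blast
  have stage: "\<exists>n. set l \<subseteq> D n" if "set l \<subseteq> D'" for l
    using that
  proof (induction l)
    case (Cons a l)
    then obtain n m where "set l \<subseteq> D n" "a \<in> D m" by (auto simp: D'_def)
    then have "set (a # l) \<subseteq> D (max n m)"
      using mono(1)[of n "max n m"] mono(1)[of m "max n m"] by auto
    then show ?case by blast
  qed auto
  have asg_ex: "\<exists>l n. set l \<subseteq> D n \<and> (\<forall>x\<in>X. asg l x = v x)"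
    if X: "finite X" and v: "range v \<subseteq> D'" for X v
  proof -
    obtain k where k: "\<forall>x\<in>X. x < k" using X finite_nat_set_iff_bounded by blast
    have "set (map v [0..<k]) \<subseteq> D'" using v by auto
    then obtain n where "set (map v [0..<k]) \<subseteq> D n" using stage by blast
    moreover have "\<forall>x\<in>X. asg (map v [0..<k]) x = v x" using k by (auto simp: asg_def)
    ultimately show ?thesis by blast
  qed
  have W': "W (?A \<psi> x \<pi> v) \<subseteq> D'" if \<pi>: "\<pi> \<in> P'" and v: "range v \<subseteq> D'" for \<psi> x \<pi> v
  proof -
    obtain l n where l: "set l \<subseteq> D n" and eq: "\<forall>y\<in>fv \<psi>. asg l y = v y"
      using asg_ex[OF finite_fv v] by blast
    obtain m where m: "\<pi> \<in> P m" using \<pi> by (auto simp: P'_def)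
    have "holds M \<psi> \<pi> ((asg l)(x := d)) = holds M \<psi> \<pi> (v(x := d))" for d
      by (rule holds_cong) (use eq in auto)
    then have A: "?A \<psi> x \<pi> (asg l) = ?A \<psi> x \<pi> v" by simp
    have "l \<in> lists (D (max n m))" "\<pi> \<in> P (max n m)"
      using l m mono(1)[of n "max n m"] mono(2)[of m "max n m"] by auto
    then have "W (?A \<psi> x \<pi> (asg l)) \<subseteq> D (Suc (max n m))"
      unfolding D_Suc stepD_def by blast
    then show ?thesis unfolding A D'_def by blast
  qed
  have V': "\<exists>\<pi>\<in>st_val M e \<inter> P'. holds M \<psi> \<pi> v"
    if ex: "\<exists>\<pi>\<in>st_val M e. holds M \<psi> \<pi> v" and v: "range v \<subseteq> D'" for e \<psi> v
  proof -
    obtain l n where l: "set l \<subseteq> D n" and eq: "\<forall>y\<in>fv \<psi>. asg l y = v y"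
      using asg_ex[OF finite_fv v] by blast
    have h: "holds M \<psi> \<pi> (asg l) = holds M \<psi> \<pi> v" for \<pi>
      by (rule holds_cong) (use eq in auto)
    obtain \<pi> where \<pi>: "\<pi> \<in> V e \<psi> (asg l)" using V(3)[of e \<psi> "asg l"] ex h by auto
    have "l \<in> lists (D n)" using l by auto
    then have "V e \<psi> (asg l) \<subseteq> P (Suc n)" unfolding P_Suc stepP_def by blast
    then have "\<pi> \<in> P'" using \<pi> by (auto simp: P'_def)
    moreover have "\<pi> \<in> st_val M e" "holds M \<psi> \<pi> v" using V(1) \<pi> h by blast+
    ultimately show ?thesis by blast
  qed
  define N :: "('d, 'p) st_struct" where
    "N = \<lparr>domain = D', precs = P', sigma = (\<lambda>s. sigma M s \<inter> P'),
          gam = (\<lambda>\<pi>. \<lparr>pred_int = (\<lambda>R. pred_int (gam M \<pi>) R \<inter> lists D'),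
                       const_int = const_int (gam M \<pi>)\<rparr>)\<rparr>"
  have stN: "standpoint_structure N"
  proof -
    have "pred_int (gam M \<pi>) (p, k) \<inter> lists D' \<subseteq> {ds. length ds = k \<and> set ds \<subseteq> D'}"
      if "\<pi> \<in> P'" for \<pi> p k
    proof -
      have "\<pi> \<in> precs M" using that P'M by blast
      then have "pred_int (gam M \<pi>) (p, k) \<subseteq> {ds. length ds = k}"
        using standpoint_structureD(5)[OF stM] by blast
      then show ?thesis by auto
    qed
    moreover have "const_int (gam M \<pi>) c = const_int (gam M \<pi>') c"
      if "\<pi> \<in> P'" "\<pi>' \<in> P'" for \<pi> \<pi>' c
      using standpoint_structureD(7)[OF stM] that P'M by blast
    moreover have "sigma M Star \<inter> P' = P'"
      using standpoint_structureD(4)[OF stM] P'M by blast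
    ultimately show ?thesis
      using d0' \<pi>0' const' unfolding standpoint_structure_def N_def st_struct.simps fo_struct.simps
      by blast
  qed
  have val: "st_val N e = st_val M e \<inter> P'" for e
    by (induction e) (auto simp: N_def)
  have trm: "trm_val (gam N \<pi>) v t = trm_val (gam M \<pi>) v t" for \<pi> v t
    by (cases t) (simp_all add: N_def)
  have in_D': "trm_val (gam M \<pi>) v t \<in> D'" if "\<pi> \<in> P'" "range v \<subseteq> D'" for \<pi> v t
    using that const' by (cases t) auto
  have elem: "holds N \<psi> \<pi> v = holds M \<psi> \<pi> v" if "\<pi> \<in> P'" "range v \<subseteq> D'" for \<psi> \<pi> v
    using that
  proof (induction \<psi> arbitrary: \<pi> v)
    case (Pred p ts)
    have "map (trm_val (gam N \<pi>) v) ts = map (trm_val (gam M \<pi>) v) ts"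
      using trm by simp
    moreover have "map (trm_val (gam M \<pi>) v) ts \<in> lists D'" using in_D'[OF Pred] by auto
    moreover have "pred_int (gam N \<pi>) R = pred_int (gam M \<pi>) R \<inter> lists D'" for R
      by (simp add: N_def)
    ultimately show ?case by (simp only: holds.simps) blast
  next
    case (Count c n x \<psi>)
    have "holds N \<psi> \<pi> (v(x := d)) = holds M \<psi> \<pi> (v(x := d))" if "d \<in> D'" for d
      by (rule Count.IH) (use Count.prems that in auto)
    then have A': "{d \<in> domain N. holds N \<psi> \<pi> (v(x := d))} = ?A \<psi> x \<pi> v \<inter> D'"
      using D'M by (auto simp: N_def)
    show ?case
    proof (cases "finite (?A \<psi> x \<pi> v)")
      case True
      then have "?A \<psi> x \<pi> v \<subseteq> D'" using W'[OF Count.prems] W(3) by metis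
      then have "?A \<psi> x \<pi> v \<inter> D' = ?A \<psi> x \<pi> v" by blast
      then show ?thesis using A' by (simp only: holds.simps)
    next
      case False
      have "W (?A \<psi> x \<pi> v) \<subseteq> ?A \<psi> x \<pi> v \<inter> D'"
        using W'[OF Count.prems] W(1) by (metis (lifting) le_inf_iff)
      then have "infinite (?A \<psi> x \<pi> v \<inter> D')" using W(4)[OF False] finite_subset by blast
      then have "count_holds c (?A \<psi> x \<pi> v \<inter> D') n = count_holds c (?A \<psi> x \<pi> v) n"
        using False by (cases c) simp_all
      then show ?thesis using A' by (simp only: holds.simps)
    qed
  next
    case (Dia e \<psi>)
    have "holds N \<psi> \<pi>' v = holds M \<psi> \<pi>' v" if "\<pi>' \<in> P'" for \<pi>'
      using Dia that by blast
    then have "(\<exists>\<pi>'\<in>st_val N e. holds N \<psi> \<pi>' v) \<longleftrightarrow> (\<exists>\<pi>'\<in>st_val M e \<inter> P'. holds M \<psi> \<pi>' v)"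
      by (auto simp: val)
    also have "\<dots> \<longleftrightarrow> (\<exists>\<pi>'\<in>st_val M e. holds M \<psi> \<pi>' v)"
      using V'[OF _ Dia.prems(2)] by (meson IntD1)
    finally show ?case by (simp only: holds.simps)
  qed (simp_all add: trm)
  have "is_model N \<phi>"
    unfolding is_model_def
  proof (intro conjI ballI allI impI)
    fix \<pi> and v :: "nat \<Rightarrow> 'd"
    assume *: "\<pi> \<in> precs N" "range v \<subseteq> domain N"
    then have "\<pi> \<in> P'" "range v \<subseteq> D'" by (simp_all add: N_def)
    moreover from this have "holds M \<phi> \<pi> v"
      using M P'M D'M by (auto simp: is_model_def)
    ultimately show "holds N \<phi> \<pi> v" using elem by simp
  qed (rule stN)
  then show ?thesis
    by (rule satisfiable_countable) (simp_all add: N_def cD' cP')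
qed


section \<open>Polynomial-time computability\<close>

subsection \<open>Multi-tape Turing machines\<close>

text \<open>
  A deterministic machine with \<open>tapes M\<close> two-way infinite tapes over the alphabet \<open>'a\<close> (of class
  \<open>finite\<close> where it matters) extended by the blank symbol \<open>None\<close>, and with the states
  \<open>{0..<states M}\<close>. A configuration consists of a state and, per tape, contents and head position.
\<close>

datatype move = MLeft | MStay | MRight

record 'a tm =
  tapes :: nat
  states :: nat
  start_state :: nat
  halt_state :: nat
  trans :: "nat \<Rightarrow> 'a option list \<Rightarrow> nat \<times> ('a option \<times> move) list"

definition wf_tm :: "'a tm \<Rightarrow> bool" where
  "wf_tm M \<longleftrightarrow> tapes M \<ge> 1 \<and> start_state M < states M \<and> halt_state M < states M \<and>
     (\<forall>q<states M. \<forall>as. length as = tapes M \<longrightarrow>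
        fst (trans M q as) < states M \<and> length (snd (trans M q as)) = tapes M)"

type_synonym 'a tape = "(int \<Rightarrow> 'a option) \<times> int"
type_synonym 'a config = "nat \<times> 'a tape list"

fun move_head :: "move \<Rightarrow> int \<Rightarrow> int" where
  "move_head MLeft h = h - 1"
| "move_head MStay h = h"
| "move_head MRight h = h + 1"

fun act :: "'a option \<times> move \<Rightarrow> 'a tape \<Rightarrow> 'a tape" where
  "act (a, m) (f, h) = (f(h := a), move_head m h)"

definition step :: "'a tm \<Rightarrow> 'a config \<Rightarrow> 'a config" where
  "step M c = (case c of (q, ts) \<Rightarrow>
     if q = halt_state M then c
     else (case trans M q (map (\<lambda>(f, h). f h) ts) of (q', acts) \<Rightarrow> (q', map2 act acts ts)))"

definition word_on_tape :: "'a list \<Rightarrow> int \<Rightarrow> 'a option" where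
  "word_on_tape w i = (if 0 \<le> i \<and> i < int (length w) then Some (w ! nat i) else None)"

text \<open>The input is on the first tape, the output on the last one.\<close>

definition init_config :: "'a tm \<Rightarrow> 'a list \<Rightarrow> 'a config" where
  "init_config M w =
     (start_state M, (word_on_tape w, 0) # replicate (tapes M - 1) (\<lambda>_. None, 0))"

definition halts_with :: "'a tm \<Rightarrow> 'a config \<Rightarrow> 'a list \<Rightarrow> bool" where
  "halts_with M c u \<longleftrightarrow> fst c = halt_state M \<and> fst (last (snd c)) = word_on_tape u"

definition polytime_computable ::
    "('x \<Rightarrow> 'a::finite list) \<Rightarrow> ('y \<Rightarrow> 'a list) \<Rightarrow> ('x \<Rightarrow> 'y) \<Rightarrow> bool" where
  "polytime_computable encX encY f \<longleftrightarrow>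
     (\<exists>M (b :: nat poly). wf_tm M \<and>
        (\<forall>x. \<exists>t \<le> poly b (length (encX x)).
            halts_with M ((step M ^^ t) (init_config M (encX x))) (encY (f x))))"


subsection \<open>Formulas as words\<close>

text \<open>
  Formulas are written in prefix notation over a finite alphabet. Numbers (names and the
  bounds of counting quantifiers) are written in binary, most significant digit first, with
  \<open>0\<close> as the empty digit sequence, and terminated by \<open>Hash\<close>.
\<close>

datatype letter =
    Dig0 | Dig1 | Hash
  | LVar | LConst
  | LStar | LSt | LInter | LUnion | LDiff
  | LAtMost | LExactly | LAtLeast
  | LPred | LEnd | LEq | LNeg | LConj | LCount | LDia

instance letter :: finite
proof
  have "UNIV = {Dig0, Dig1, Hash, LVar, LConst, LStar, LSt, LInter, LUnion, LDiff,
      LAtMost, LExactly, LAtLeast, LPred, LEnd, LEq, LNeg, LConj, LCount, LDia}"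
    (is "_ = ?A")
  proof
    show "UNIV \<subseteq> ?A"
    proof
      fix x show "x \<in> ?A" by (cases x) simp_all
    qed
  qed simp
  moreover have "finite ?A" by simp
  ultimately show "finite (UNIV :: letter set)" by simp
qed

fun digits :: "nat \<Rightarrow> letter list" where
  "digits n = (if n = 0 then [] else digits (n div 2) @ [if even n then Dig0 else Dig1])"

declare digits.simps [simp del]

definition enc_nat :: "nat \<Rightarrow> letter list" where
  "enc_nat n = digits n @ [Hash]"

primrec enc_trm :: "trm \<Rightarrow> letter list" where
  "enc_trm (Var x) = LVar # enc_nat x"
| "enc_trm (Const c) = LConst # enc_nat c"

primrec enc_stsym :: "stsym \<Rightarrow> letter list" where
  "enc_stsym Star = [LStar]"
| "enc_stsym (St s) = LSt # enc_nat s"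

primrec enc_stexp :: "stexp \<Rightarrow> letter list" where
  "enc_stexp (Sym s) = enc_stsym s"
| "enc_stexp (Cap e f) = LInter # enc_stexp e @ enc_stexp f"
| "enc_stexp (Cup e f) = LUnion # enc_stexp e @ enc_stexp f"
| "enc_stexp (Minus e f) = LDiff # enc_stexp e @ enc_stexp f"

primrec enc_cmp :: "cmp \<Rightarrow> letter" where
  "enc_cmp AtMost = LAtMost"
| "enc_cmp Exactly = LExactly"
| "enc_cmp AtLeast = LAtLeast"

primrec enc_fmla :: "fmla \<Rightarrow> letter list" where
  "enc_fmla (Pred p ts) = LPred # enc_nat p @ concat (map enc_trm ts) @ [LEnd]"
| "enc_fmla (Eq s t) = LEq # enc_trm s @ enc_trm t"
| "enc_fmla (Neg \<phi>) = LNeg # enc_fmla \<phi>"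
| "enc_fmla (Conj \<phi> \<psi>) = LConj # enc_fmla \<phi> @ enc_fmla \<psi>"
| "enc_fmla (Count c n x \<phi>) = LCount # enc_cmp c # enc_nat n @ enc_nat x @ enc_fmla \<phi>"
| "enc_fmla (Dia e \<phi>) = LDia # enc_stexp e @ enc_fmla \<phi>"

text \<open>The encoding is faithful; in fact the code words form a prefix code.\<close>

lemma Hash_notin_digits: "Hash \<notin> set (digits n)"
  by (induction n rule: digits.induct) (subst digits.simps, auto)

lemma digits_inject: "digits m = digits n \<Longrightarrow> m = n"
proof -
  define val where "val = foldl (\<lambda>a b. 2 * a + (if b = Dig0 then 0 else 1 :: nat)) 0"
  have "val (digits n) = n" for n
  proof (induction n rule: digits.induct)
    case (1 n)
    then show ?case by (subst digits.simps) (auto simp: val_def)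
  qed
  then show "digits m = digits n \<Longrightarrow> m = n" by metis
qed

lemma enc_nat_prefix: "enc_nat m @ r = enc_nat n @ s \<Longrightarrow> m = n \<and> r = s"
proof -
  have *: "takeWhile (\<lambda>a. a \<noteq> Hash) (enc_nat n @ s) = digits n" for n s
    using Hash_notin_digits[of n] by (auto simp: enc_nat_def takeWhile_append)
  assume eq: "enc_nat m @ r = enc_nat n @ s"
  then have "digits m = digits n" using * by metis
  then show ?thesis using eq digits_inject by auto
qed

lemma enc_trm_prefix: "enc_trm t @ r = enc_trm u @ s \<Longrightarrow> t = u \<and> r = s"
  by (cases t; cases u) (auto dest: enc_nat_prefix)

lemma enc_trms_prefix:
  "concat (map enc_trm ts) @ LEnd # r = concat (map enc_trm us) @ LEnd # s \<Longrightarrow> ts = us \<and> r = s"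
proof (induction ts arbitrary: us)
  case Nil
  then show ?case by (cases us; cases "hd us") auto
next
  case (Cons t ts)
  then show ?case
  proof (cases us)
    case Nil
    then show ?thesis using Cons.prems by (cases t) auto
  next
    case (Cons u us')
    then show ?thesis using Cons.prems Cons.IH[of us'] enc_trm_prefix[of t _ u] by auto
  qed
qed

lemma enc_stsym_prefix: "enc_stsym a @ r = enc_stsym b @ s \<Longrightarrow> a = b \<and> r = s"
  by (cases a; cases b) (auto dest: enc_nat_prefix)

lemma enc_stexp_hd:
  "hd (enc_stexp e @ r) =
    (case e of Sym Star \<Rightarrow> LStar | Sym (St _) \<Rightarrow> LSt | Cap _ _ \<Rightarrow> LInter | Cup _ _ \<Rightarrow> LUnion
     | Minus _ _ \<Rightarrow> LDiff)"
  by (cases e) (auto split: stsym.split)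

lemma enc_stexp_prefix: "enc_stexp e @ r = enc_stexp f @ s \<Longrightarrow> e = f \<and> r = s"
proof (induction e arbitrary: f r s)
  case (Sym a)
  from arg_cong[OF Sym, of hd] obtain b where f: "f = Sym b"
    unfolding enc_stexp_hd by (cases f) (simp_all split: stsym.splits)
  then show ?case using Sym enc_stsym_prefix by auto
next
  case (Cap e1 e2)
  from arg_cong[OF Cap.prems, of hd] obtain f1 f2 where f: "f = Cap f1 f2"
    unfolding enc_stexp_hd by (cases f) (simp_all split: stsym.splits)
  have "enc_stexp e1 @ enc_stexp e2 @ r = enc_stexp f1 @ enc_stexp f2 @ s"
    using Cap.prems f by simp
  then show ?case using Cap.IH f by blast
next
  case (Cup e1 e2)
  from arg_cong[OF Cup.prems, of hd] obtain f1 f2 where f: "f = Cup f1 f2"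
    unfolding enc_stexp_hd by (cases f) (simp_all split: stsym.splits)
  have "enc_stexp e1 @ enc_stexp e2 @ r = enc_stexp f1 @ enc_stexp f2 @ s"
    using Cup.prems f by simp
  then show ?case using Cup.IH f by blast
next
  case (Minus e1 e2)
  from arg_cong[OF Minus.prems, of hd] obtain f1 f2 where f: "f = Minus f1 f2"
    unfolding enc_stexp_hd by (cases f) (simp_all split: stsym.splits)
  have "enc_stexp e1 @ enc_stexp e2 @ r = enc_stexp f1 @ enc_stexp f2 @ s"
    using Minus.prems f by simp
  then show ?case using Minus.IH f by blast
qed

lemma enc_cmp_inject: "enc_cmp c = enc_cmp d \<Longrightarrow> c = d"
  by (cases c; cases d) auto

lemma enc_fmla_prefix: "enc_fmla \<phi> @ r = enc_fmla \<psi> @ s \<Longrightarrow> \<phi> = \<psi> \<and> r = s"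
proof (induction \<phi> arbitrary: \<psi> r s)
  case (Pred p ts)
  then show ?case by (cases \<psi>) (auto dest!: enc_nat_prefix enc_trms_prefix)
next
  case (Eq t u)
  then show ?case by (cases \<psi>) (auto dest!: enc_trm_prefix)
next
  case (Neg \<phi>)
  then show ?case by (cases \<psi>) auto
next
  case (Conj \<phi>1 \<phi>2)
  obtain \<psi>1 \<psi>2 where \<psi>: "\<psi> = Conj \<psi>1 \<psi>2"
    using Conj.prems by (cases \<psi>) simp_all
  have "enc_fmla \<phi>1 @ enc_fmla \<phi>2 @ r = enc_fmla \<psi>1 @ enc_fmla \<psi>2 @ s"
    using Conj.prems \<psi> by simp
  then show ?case using Conj.IH \<psi> by blast
next
  case (Count c n x \<phi>)
  then show ?case by (cases \<psi>) (auto dest!: enc_nat_prefix enc_cmp_inject)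
next
  case (Dia e \<phi>)
  then show ?case by (cases \<psi>) (auto dest!: enc_stexp_prefix)
qed

lemma inj_enc_fmla: "inj enc_fmla"
  by (rule injI) (metis enc_fmla_prefix)

end

theory Submission
  imports Defs
begin

text \<open>
  Replace a nullary atom \<open>P()\<close> by \<open>P'(c)\<close>, where \<open>P'\<close> is a unary predicate and \<open>c\<close> an
  arbitrary constant: only the truth value of \<open>P'\<close> at \<open>c\<close> matters, so \<open>c\<close> need not be fresh.
  To keep \<open>P'\<close> apart from the unary predicates of the formula, the names \<open>p\<close> of nullary
  predicates become \<open>4p + 2\<close> and all other names become \<open>4p + 3\<close>. In binary this appends the
  digits \<open>10\<close> or \<open>11\<close>, without leading zeros even if \<open>p = 0\<close>. Hence a one-pass transducer
  with one letter of lookahead (is the argument list empty?) performs the translation in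
  linear time.
\<close>

section \<open>The translation\<close>

primrec elim_nullary :: "fmla \<Rightarrow> fmla" where
  "elim_nullary (Pred p ts) =
     (if ts = [] then Pred (4 * p + 2) [Const 0] else Pred (4 * p + 3) ts)"
| "elim_nullary (Eq s t) = Eq s t"
| "elim_nullary (Neg \<phi>) = Neg (elim_nullary \<phi>)"
| "elim_nullary (Conj \<phi> \<psi>) = Conj (elim_nullary \<phi>) (elim_nullary \<psi>)"
| "elim_nullary (Count c n x \<phi>) = Count c n x (elim_nullary \<phi>)"
| "elim_nullary (Dia e \<phi>) = Dia e (elim_nullary \<phi>)"

section \<open>Syntactic properties preserved by the translation\<close>

lemma fv_elim_nullary [simp]: "fv (elim_nullary \<phi>) = fv \<phi>"
  by (induction \<phi>) auto

lemma vars_elim_nullary [simp]: "vars (elim_nullary \<phi>) = vars \<phi>"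
  by (induction \<phi>) auto

lemma subfmlas_elim_nullary: "subfmlas (elim_nullary \<phi>) = elim_nullary ` subfmlas \<phi>"
  by (induction \<phi>) auto

text \<open>Atoms go to atoms and every other constructor to itself, so modal subformulas of the
  translation arise only from modal subformulas of \<open>\<phi>\<close>. S5 and monodicity carry
  over this way.\<close>

lemma Dia_subfmlas_elim_nullary:
  assumes "Dia e \<chi> \<in> subfmlas (elim_nullary \<phi>)"
  obtains \<psi> where "Dia e \<psi> \<in> subfmlas \<phi>" "\<chi> = elim_nullary \<psi>"
proof -
  obtain \<rho> where \<rho>: "\<rho> \<in> subfmlas \<phi>" "Dia e \<chi> = elim_nullary \<rho>"
    using assms by (auto simp: subfmlas_elim_nullary)
  then show ?thesis using that by (cases \<rho>) (auto split: if_splits)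
qed

lemma nullary_free_elim_nullary: "nullary_free (elim_nullary \<phi>)"
  unfolding nullary_free_def by (induction \<phi>) auto

text \<open>Only arity \<open>0\<close> changes, to \<open>1\<close>, and the added constant brings
  no variable.\<close>

lemma is_C2_elim_nullary: "is_C2 \<phi> \<Longrightarrow> is_C2 (elim_nullary \<phi>)"
proof -
  have "(\<forall>(p, k)\<in>preds \<phi>. k \<le> 2) \<Longrightarrow> (\<forall>(p, k)\<in>preds (elim_nullary \<phi>). k \<le> 2)"
    by (induction \<phi>) auto
  then show "is_C2 \<phi> \<Longrightarrow> is_C2 (elim_nullary \<phi>)" by (simp add: is_C2_def)
qed

lemma is_S5_elim_nullary: "is_S5 \<phi> \<Longrightarrow> is_S5 (elim_nullary \<phi>)"
  unfolding is_S5_def by (metis Dia_subfmlas_elim_nullary)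

lemma monodic_elim_nullary: "monodic \<phi> \<Longrightarrow> monodic (elim_nullary \<phi>)"
  unfolding monodic_def by (metis Dia_subfmlas_elim_nullary fv_elim_nullary)


section \<open>Equisatisfiability\<close>

text \<open>The hypotheses do not say which structure is built from which, so both directions of
  equisatisfiability can use them. Beyond atoms nothing changes, since domains and standpoints
  agree.\<close>

lemma holds_elim_nullary:
  assumes dom: "domain N = domain M" and sig: "sigma N = sigma M"
    and const: "\<And>\<pi>. const_int (gam N \<pi>) = const_int (gam M \<pi>)"
    and null: "\<And>\<pi> p. [const_int (gam N \<pi>) 0] \<in> pred_int (gam N \<pi>) (4 * p + 2, 1)
      \<longleftrightarrow> [] \<in> pred_int (gam M \<pi>) (p, 0)"
    and pos: "\<And>\<pi> p k. k \<noteq> 0 \<Longrightarrow>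
      pred_int (gam N \<pi>) (4 * p + 3, k) = pred_int (gam M \<pi>) (p, k)"
  shows "holds N (elim_nullary \<phi>) \<pi> v = holds M \<phi> \<pi> v"
proof (induction \<phi> arbitrary: \<pi> v)
  have trm: "trm_val (gam N \<pi>) v = trm_val (gam M \<pi>) v" for \<pi> v
  proof
    show "trm_val (gam N \<pi>) v t = trm_val (gam M \<pi>) v t" for t by (cases t) (simp_all add: const)
  qed
  {
    case (Pred p ts)
    show ?case
      using null[of \<pi> p, unfolded const] pos[of "length ts" \<pi> p] by (cases "ts = []") (simp_all add: trm)
  next
    case (Eq s t)
    show ?case by (simp add: trm)
  next
    case (Dia e \<phi>)
    have "st_val N e = st_val M e" by (induction e) (simp_all add: sig)
    with Dia show ?case by simp
  }
qed (simp_all add: dom)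

text \<open>Both model constructions keep the domain, the standpoints and the rigid constants, so
  only the predicate extensions need checking.\<close>

lemma standpoint_structure_update_gam:
  assumes "standpoint_structure M"
    and "\<And>\<pi> p k. \<pi> \<in> precs M \<Longrightarrow>
      pred_int (I \<pi>) (p, k) \<subseteq> {ds. length ds = k \<and> set ds \<subseteq> domain M}"
    and "\<And>\<pi>. const_int (I \<pi>) = const_int (gam M \<pi>)"
  shows "standpoint_structure (M\<lparr>gam := I\<rparr>)"
proof -
  let ?N = "M\<lparr>gam := I\<rparr>"
  have eqs: "domain ?N = domain M" "precs ?N = precs M" "sigma ?N = sigma M" "gam ?N = I"
    by simp_all
  show ?thesis
    using assms(1,2) unfolding standpoint_structure_def eqs assms(3) by blast
qed

lemma satisfiable_elim_nullary:
  assumes "satisfiable \<phi>"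
  shows "satisfiable (elim_nullary \<phi>)"
proof -
  obtain M :: "(nat, nat) st_struct" where M: "is_model M \<phi>"
    using assms by (auto simp: satisfiable_def)
  \<comment> \<open>\<open>q div 4\<close> recovers the old name. The code of a true nullary
    predicate holds of the value of \<open>Const 0\<close> alone, that of a false one of nothing.
    Names that the translation never produces get a default extension of the right arity.\<close>
  define I where "I \<pi> = \<lparr>pred_int = (\<lambda>(q, k).
      if k = 1 \<and> q mod 4 = 2
      then if [] \<in> pred_int (gam M \<pi>) (q div 4, 0) then {[const_int (gam M \<pi>) 0]} else {}
      else pred_int (gam M \<pi>) (q div 4, k)),
    const_int = const_int (gam M \<pi>)\<rparr>" for \<pi>
  define N where "N = M\<lparr>gam := I\<rparr>"
  have div: "(4 * p + 2) div 4 = p" "(4 * p + 3) div 4 = p"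
    "(4 * p + 2) mod 4 = 2" "(4 * p + 3) mod 4 = 3" for p :: nat
    by presburger+
  have "holds N (elim_nullary \<phi>) \<pi> v = holds M \<phi> \<pi> v" for \<pi> v
    by (rule holds_elim_nullary) (simp_all add: N_def I_def div del: One_nat_def add_2_eq_Suc')
  moreover have "standpoint_structure N"
    unfolding N_def
  proof (rule standpoint_structure_update_gam)
    show M': "standpoint_structure M" using M by (simp add: is_model_def)
    show "pred_int (I \<pi>) (q, k) \<subseteq> {ds. length ds = k \<and> set ds \<subseteq> domain M}"
      if "\<pi> \<in> precs M" for \<pi> q k
      using standpoint_structureD(5,6)[OF M' that] by (simp add: I_def)
  qed (simp add: I_def)
  ultimately have "is_model N (elim_nullary \<phi>)"
    using M by (simp add: is_model_def N_def)
  then show ?thesis by (auto simp: satisfiable_def)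
qed

lemma satisfiable_of_elim_nullary:
  assumes "satisfiable (elim_nullary \<phi>)"
  shows "satisfiable \<phi>"
proof -
  obtain N :: "(nat, nat) st_struct" where N: "is_model N (elim_nullary \<phi>)"
    using assms by (auto simp: satisfiable_def)
  \<comment> \<open>The code of a nullary predicate is read off at the value of
    \<open>Const 0\<close>; its behaviour at other elements is discarded.\<close>
  define I where "I \<pi> = \<lparr>pred_int = (\<lambda>(p, k).
      if k = 0
      then if [const_int (gam N \<pi>) 0] \<in> pred_int (gam N \<pi>) (4 * p + 2, 1) then {[]} else {}
      else pred_int (gam N \<pi>) (4 * p + 3, k)),
    const_int = const_int (gam N \<pi>)\<rparr>" for \<pi>
  define M where "M = N\<lparr>gam := I\<rparr>"
  have "holds N (elim_nullary \<phi>) \<pi> v = holds M \<phi> \<pi> v" for \<pi> v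
    by (rule holds_elim_nullary) (simp_all add: M_def I_def del: One_nat_def add_2_eq_Suc')
  moreover have "standpoint_structure M"
    unfolding M_def
  proof (rule standpoint_structure_update_gam)
    show N': "standpoint_structure N" using N by (simp add: is_model_def)
    show "pred_int (I \<pi>) (p, k) \<subseteq> {ds. length ds = k \<and> set ds \<subseteq> domain N}"
      if "\<pi> \<in> precs N" for \<pi> p k
      using standpoint_structureD(5)[OF N' that] by (simp add: I_def)
  qed (simp add: I_def)
  ultimately have "is_model M \<phi>"
    using N by (simp add: is_model_def M_def)
  then show ?thesis by (auto simp: satisfiable_def)
qed


section \<open>The transducer\<close>

text \<open>
  The input letter \<open>a\<close> in state \<open>q\<close> yields the next state, the letter written, and whether the
  input head advances. State \<open>0\<close> copies; \<open>1\<close> copies the name of a predicate; \<open>2\<close> looks at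
  the letter after the name and leads to \<open>3\<close>--\<open>6\<close>, which write the rest of a formerly
  nullary atom, or to \<open>7\<close>, which terminates the new name; \<open>8\<close> is the halting state.
\<close>

definition elim_trans :: "nat \<Rightarrow> letter option \<Rightarrow> nat \<times> letter option \<times> bool" where
  "elim_trans q a =
     (if q = 0 then
        (case a of None \<Rightarrow> (8, None, False) | Some l \<Rightarrow> (if l = LPred then 1 else 0, a, True))
      else if q = 1 then (if a = Some Hash then (2, Some Dig1, True) else (1, a, True))
      else if q = 2 then
        (if a = Some LEnd then (3, Some Dig0, False) else (7, Some Dig1, False))
      else if q = 3 then (4, Some Hash, False)
      else if q = 4 then (5, Some LConst, False)
      else if q = 5 then (6, Some Hash, False)
      else if q = 6 then (0, Some LEnd, True)
      else (0, Some Hash, False))"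

text \<open>The input tape is never changed. Each step before halting writes one output cell and
  moves right, so letters are appended one per step.\<close>

definition elim_tm :: "letter tm" where
  "elim_tm = \<lparr>tapes = 2, states = 9, start_state = 0, halt_state = 8,
     trans = (\<lambda>q as. case elim_trans q (hd as) of (q', b, adv) \<Rightarrow>
       (q', [(hd as, if adv then MRight else MStay), (b, MRight)]))\<rparr>"

lemma wf_elim_tm: "wf_tm elim_tm"
  by (auto simp: wf_tm_def elim_tm_def elim_trans_def split: option.split)

text \<open>The letters \<open>xs\<close> have been read, \<open>r\<close> is still to be read, and \<open>u\<close> has been written.\<close>

definition conf :: "nat \<Rightarrow> letter list \<Rightarrow> letter list \<Rightarrow> letter list \<Rightarrow> letter config" where
  "conf q xs r u =
     (q, [(word_on_tape (xs @ r), int (length xs)), (word_on_tape u, int (length u))])"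

section \<open>Step-bounded runs of the transducer\<close>

definition reach :: "nat \<Rightarrow> letter config \<Rightarrow> letter config \<Rightarrow> bool" where
  "reach n c d \<longleftrightarrow> (\<exists>t\<le>n. (step elim_tm ^^ t) c = d)"

lemma reach_trans: "reach m c d \<Longrightarrow> reach n d e \<Longrightarrow> reach (m + n) c e"
proof -
  assume "reach m c d" "reach n d e"
  then obtain s t where *: "s \<le> m" "(step elim_tm ^^ s) c = d"
    "t \<le> n" "(step elim_tm ^^ t) d = e"
    by (auto simp: reach_def)
  then have "(step elim_tm ^^ (t + s)) c = e" by (simp add: funpow_add)
  with * show ?thesis unfolding reach_def by (intro exI[of _ "t + s"]) auto
qed

lemma reach_refl: "reach 0 c c"
  by (simp add: reach_def)

lemma reach_mono: "reach m c d \<Longrightarrow> m \<le> n \<Longrightarrow> reach n c d"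
  unfolding reach_def by (metis le_trans)

lemma reach_step: "step elim_tm c = d \<Longrightarrow> reach 1 c d"
  unfolding reach_def by (intro exI[of _ 1]) simp

lemma word_on_tape_snoc: "(word_on_tape u)(int (length u) := Some a) = word_on_tape (u @ [a])"
  by (rule ext) (auto simp: word_on_tape_def nth_append)

lemma word_on_tape_append_Cons: "word_on_tape (xs @ a # r) (int (length xs)) = Some a"
  by (simp add: word_on_tape_def)

lemma word_on_tape_length: "word_on_tape xs (int (length xs)) = None"
  by (simp add: word_on_tape_def)

lemma step_conf:
  assumes "q \<noteq> 8" "elim_trans q (Some a) = (q', Some b, adv)"
  shows "reach 1 (conf q xs (a # r) u)
    (if adv then conf q' (xs @ [a]) r (u @ [b]) else conf q' xs (a # r) (u @ [b]))"
  using assms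
  by (intro reach_step)
     (simp add: step_def conf_def elim_tm_def word_on_tape_append_Cons
        word_on_tape_snoc[symmetric] fun_upd_idem)

lemma step_advance:
  assumes "q \<noteq> 8" "elim_trans q (Some a) = (q', Some b, True)"
  shows "reach 1 (conf q xs (a # r) u) (conf q' (xs @ [a]) r (u @ [b]))"
  using step_conf[OF assms] by simp

lemma step_stay:
  assumes "q \<noteq> 8" "elim_trans q (Some a) = (q', Some b, False)"
  shows "reach 1 (conf q xs (a # r) u) (conf q' xs (a # r) (u @ [b]))"
  using step_conf[OF assms] by simp

text \<open>The machine writes a blank onto a blank cell. The result is not a \<open>conf\<close>,
  because the output head is now one cell too far right.\<close>

lemma step_halt: "reach 1 (conf 0 xs [] u) (8, [(word_on_tape xs, int (length xs)),
    (word_on_tape u, int (length u) + 1)])"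
  by (intro reach_step)
     (simp add: step_def conf_def elim_tm_def elim_trans_def word_on_tape_length fun_upd_idem)

text \<open>This covers both copying loops, in state \<open>0\<close> and in state
  \<open>1\<close>.\<close>

lemma reach_copy:
  assumes "\<And>a. a \<in> set w \<Longrightarrow> elim_trans q (Some a) = (q, Some a, True)" "q \<noteq> 8"
  shows "reach (length w) (conf q xs (w @ r) u) (conf q (xs @ w) r (u @ w))"
  using assms(1)
proof (induction w arbitrary: xs u)
  case Nil
  show ?case by (simp add: reach_refl)
next
  case (Cons a w)
  have "reach 1 (conf q xs (a # (w @ r)) u) (conf q (xs @ [a]) (w @ r) (u @ [a]))"
    by (rule step_advance) (use assms(2) Cons.prems in auto)
  moreover have "reach (length w) (conf q (xs @ [a]) (w @ r) (u @ [a]))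
      (conf q ((xs @ [a]) @ w) r ((u @ [a]) @ w))"
    by (rule Cons.IH) (use Cons.prems in auto)
  ultimately show ?case using reach_trans by fastforce
qed

lemma reach_copy_outside:
  assumes "LPred \<notin> set w"
  shows "reach (length w) (conf 0 xs (w @ r) u) (conf 0 (xs @ w) r (u @ w))"
  by (rule reach_copy) (use assms in \<open>auto simp: elim_trans_def\<close>)

section \<open>Letters and digits of the encoding\<close>

lemma LPred_notin_digits: "LPred \<notin> set (digits n)"
  by (induction n rule: digits.induct) (subst digits.simps, auto)

lemma LPred_notin_enc_nat: "LPred \<notin> set (enc_nat n)"
  by (simp add: enc_nat_def LPred_notin_digits)

lemma LPred_notin_enc_trm: "LPred \<notin> set (enc_trm t)"
  by (cases t) (simp_all add: LPred_notin_enc_nat)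

lemma LPred_notin_enc_stexp: "LPred \<notin> set (enc_stexp e)"
proof (induction e)
  case (Sym s)
  show ?case by (cases s) (simp_all add: LPred_notin_enc_nat)
qed simp_all

lemma LPred_neq_enc_cmp: "LPred \<noteq> enc_cmp c"
  by (cases c) simp_all

text \<open>\<open>LPred\<close> occurs only at the start of atoms, so state \<open>0\<close> copies
  everything between atoms verbatim.\<close>

lemmas LPred_notin =
  LPred_notin_enc_nat LPred_notin_enc_trm LPred_notin_enc_stexp LPred_neq_enc_cmp

lemma digits_double: "n \<noteq> 0 \<Longrightarrow> digits (2 * n) = digits n @ [Dig0]"
  by (subst digits.simps) simp

lemma digits_Suc_double: "digits (2 * n + 1) = digits n @ [Dig1]"
  by (subst digits.simps) simp

lemma enc_nat_renamed:
  "enc_nat (4 * p + 2) = digits p @ [Dig1, Dig0, Hash]"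
  "enc_nat (4 * p + 3) = digits p @ [Dig1, Dig1, Hash]"
proof -
  \<comment> \<open>\<open>2 * p + 1\<close> is nonzero even for \<open>p = 0\<close>, as
    \<open>digits_double\<close> requires; \<open>0\<close> itself has no digits.\<close>
  have eqs: "4 * p + 2 = 2 * (2 * p + 1)" "4 * p + 3 = 2 * (2 * p + 1) + 1" by simp_all
  show "enc_nat (4 * p + 2) = digits p @ [Dig1, Dig0, Hash]"
    "enc_nat (4 * p + 3) = digits p @ [Dig1, Dig1, Hash]"
    unfolding eqs enc_nat_def by (simp_all only: digits_Suc_double digits_double) simp_all
qed

section \<open>Runs on atoms and formulas\<close>

lemma reach_enc_pred:
  "reach (length (digits p) + 2) (conf 0 xs (LPred # enc_nat p @ r) u)
     (conf 2 (xs @ LPred # enc_nat p) r (u @ LPred # digits p @ [Dig1]))"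
proof -
  let ?xs = "xs @ [LPred]" and ?u = "u @ [LPred]"
  have 1: "reach 1 (conf 0 xs (LPred # (digits p @ Hash # r)) u)
      (conf 1 ?xs (digits p @ Hash # r) ?u)"
    by (rule step_advance) (simp_all add: elim_trans_def)
  have 2: "reach (length (digits p)) (conf 1 ?xs (digits p @ Hash # r) ?u)
      (conf 1 (?xs @ digits p) (Hash # r) (?u @ digits p))"
    by (rule reach_copy) (use Hash_notin_digits in \<open>auto simp: elim_trans_def\<close>)
  \<comment> \<open>Both new names continue with \<open>Dig1\<close>, so it can be written in place
    of \<open>Hash\<close> before the lookahead.\<close>
  have 3: "reach 1 (conf 1 (?xs @ digits p) (Hash # r) (?u @ digits p))
      (conf 2 ((?xs @ digits p) @ [Hash]) r ((?u @ digits p) @ [Dig1]))"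
    by (rule step_advance) (simp_all add: elim_trans_def)
  show ?thesis
    using reach_trans[OF reach_trans[OF 1 2] 3] by (simp add: enc_nat_def)
qed

text \<open>The input head waits on \<open>LEnd\<close> for four steps: \<open>Dig0\<close>,
  \<open>Hash\<close> finish the new name, and \<open>LConst\<close>, \<open>Hash\<close> spell
  \<open>Const 0\<close>.\<close>

lemma reach_nullary:
  "reach 5 (conf 2 xs (LEnd # r) u)
     (conf 0 (xs @ [LEnd]) r (u @ [Dig0, Hash, LConst, Hash, LEnd]))"
proof -
  have 1: "reach 1 (conf 2 xs (LEnd # r) u) (conf 3 xs (LEnd # r) (u @ [Dig0]))" for u
    by (rule step_stay) (simp_all add: elim_trans_def)
  have 2: "reach 1 (conf 3 xs (LEnd # r) u) (conf 4 xs (LEnd # r) (u @ [Hash]))" for u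
    by (rule step_stay) (simp_all add: elim_trans_def)
  have 3: "reach 1 (conf 4 xs (LEnd # r) u) (conf 5 xs (LEnd # r) (u @ [LConst]))" for u
    by (rule step_stay) (simp_all add: elim_trans_def)
  have 4: "reach 1 (conf 5 xs (LEnd # r) u) (conf 6 xs (LEnd # r) (u @ [Hash]))" for u
    by (rule step_stay) (simp_all add: elim_trans_def)
  have 5: "reach 1 (conf 6 xs (LEnd # r) u) (conf 0 (xs @ [LEnd]) r (u @ [LEnd]))" for u
    by (rule step_advance) (simp_all add: elim_trans_def)
  show ?thesis
    using reach_trans[OF reach_trans[OF reach_trans[OF reach_trans[OF 1 2] 3] 4] 5]
    by (simp add: eval_nat_numeral)
qed

text \<open>The lookahead letter is not consumed, so state \<open>0\<close> can still copy the whole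
  argument list.\<close>

lemma reach_nonnullary:
  assumes "a \<noteq> LEnd"
  shows "reach 2 (conf 2 xs (a # r) u) (conf 0 xs (a # r) (u @ [Dig1, Hash]))"
proof -
  have 1: "reach 1 (conf 2 xs (a # r) u) (conf 7 xs (a # r) (u @ [Dig1]))" for u
    by (rule step_stay) (simp_all add: elim_trans_def assms)
  have 2: "reach 1 (conf 7 xs (a # r) u) (conf 0 xs (a # r) (u @ [Hash]))" for u
    by (rule step_stay) (simp_all add: elim_trans_def)
  show ?thesis using reach_trans[OF 1 2] by (simp add: numeral_2_eq_2)
qed

text \<open>Prefix notation lets runs on subformulas be chained without a stack, hence the arbitrary
  \<open>xs\<close>, \<open>r\<close>, \<open>u\<close>. The factor \<open>3\<close> accommodates
  the nullary atom named \<open>0\<close>: three letters, seven steps.\<close>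

lemma reach_enc_fmla:
  "reach (3 * length (enc_fmla \<phi>)) (conf 0 xs (enc_fmla \<phi> @ r) u)
     (conf 0 (xs @ enc_fmla \<phi>) r (u @ enc_fmla (elim_nullary \<phi>)))"
proof (induction \<phi> arbitrary: xs r u)
  case (Pred p ts)
  let ?w = "concat (map enc_trm ts) @ [LEnd]"
  have name: "reach (length (digits p) + 2) (conf 0 xs (LPred # enc_nat p @ ?w @ r) u)
      (conf 2 (xs @ LPred # enc_nat p) (?w @ r) (u @ LPred # digits p @ [Dig1]))"
    by (rule reach_enc_pred)
  show ?case
  proof (cases ts)
    case Nil
    have "reach (length (digits p) + 2 + 5) (conf 0 xs (LPred # enc_nat p @ ?w @ r) u)
      (conf 0 ((xs @ LPred # enc_nat p) @ [LEnd]) r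
        ((u @ LPred # digits p @ [Dig1]) @ [Dig0, Hash, LConst, Hash, LEnd]))"
      by (rule reach_trans[OF name]) (use Nil reach_nullary[of "xs @ LPred # enc_nat p" r "u @ LPred # digits p @ [Dig1]"]
          in simp)
    then have "reach (3 * length (enc_fmla (Pred p ts))) (conf 0 xs (LPred # enc_nat p @ ?w @ r) u)
      (conf 0 ((xs @ LPred # enc_nat p) @ [LEnd]) r
        ((u @ LPred # digits p @ [Dig1]) @ [Dig0, Hash, LConst, Hash, LEnd]))"
      by (rule reach_mono) (simp add: enc_nat_def)
    moreover have "enc_nat 0 = [Hash]" by (simp add: enc_nat_def digits.simps)
    ultimately show ?thesis
      using Nil by (simp add: enc_nat_renamed del: add_2_eq_Suc')
  next
    case (Cons t ts')
    \<comment> \<open>An argument starts with \<open>LVar\<close> or \<open>LConst\<close>, so one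
      letter tells a nonempty list from an empty one.\<close>
    obtain a w' where w: "?w = a # w'" "a \<noteq> LEnd"
      using Cons by (cases t) auto
    let ?u = "(u @ LPred # digits p @ [Dig1]) @ [Dig1, Hash]"
    have 1: "reach 2 (conf 2 (xs @ LPred # enc_nat p) (?w @ r) (u @ LPred # digits p @ [Dig1]))
        (conf 0 (xs @ LPred # enc_nat p) (?w @ r) ?u)"
      unfolding w(1) append_Cons by (rule reach_nonnullary) (rule w(2))
    have 2: "reach (length ?w) (conf 0 (xs @ LPred # enc_nat p) (?w @ r) ?u)
        (conf 0 ((xs @ LPred # enc_nat p) @ ?w) r (?u @ ?w))"
      by (rule reach_copy_outside) (auto simp: LPred_notin)
    have "reach (3 * length (enc_fmla (Pred p ts))) (conf 0 xs (LPred # enc_nat p @ ?w @ r) u)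
        (conf 0 ((xs @ LPred # enc_nat p) @ ?w) r (?u @ ?w))"
      by (rule reach_mono[OF reach_trans[OF reach_trans[OF name 1] 2]]) (simp add: enc_nat_def)
    then show ?thesis using Cons by (simp add: enc_nat_renamed)
  qed
next
  case (Eq s t)
  have "reach (length (enc_fmla (Eq s t))) (conf 0 xs (enc_fmla (Eq s t) @ r) u)
     (conf 0 (xs @ enc_fmla (Eq s t)) r (u @ enc_fmla (Eq s t)))"
    by (rule reach_copy_outside) (auto simp: LPred_notin)
  then have "reach (3 * length (enc_fmla (Eq s t))) (conf 0 xs (enc_fmla (Eq s t) @ r) u)
     (conf 0 (xs @ enc_fmla (Eq s t)) r (u @ enc_fmla (Eq s t)))"
    by (rule reach_mono) simp
  then show ?case by simp
next
  case (Neg \<phi>)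
  have "reach (length [LNeg]) (conf 0 xs ([LNeg] @ enc_fmla \<phi> @ r) u)
      (conf 0 (xs @ [LNeg]) (enc_fmla \<phi> @ r) (u @ [LNeg]))"
    by (rule reach_copy_outside) simp
  from reach_mono[OF reach_trans[OF this Neg.IH], of "3 * length (enc_fmla (Neg \<phi>))"]
  show ?case by simp
next
  case (Conj \<phi> \<psi>)
  have "reach (length [LConj]) (conf 0 xs ([LConj] @ enc_fmla \<phi> @ enc_fmla \<psi> @ r) u)
      (conf 0 (xs @ [LConj]) (enc_fmla \<phi> @ enc_fmla \<psi> @ r) (u @ [LConj]))"
    by (rule reach_copy_outside) simp
  from reach_mono[OF reach_trans[OF reach_trans[OF this Conj.IH(1)] Conj.IH(2)],
      of "3 * length (enc_fmla (Conj \<phi> \<psi>))"]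
  show ?case by simp
next
  case (Count c n x \<phi>)
  let ?w = "LCount # enc_cmp c # enc_nat n @ enc_nat x"
  have "reach (length ?w) (conf 0 xs (?w @ enc_fmla \<phi> @ r) u)
      (conf 0 (xs @ ?w) (enc_fmla \<phi> @ r) (u @ ?w))"
    by (rule reach_copy_outside) (simp add: LPred_notin)
  from reach_mono[OF reach_trans[OF this Count.IH], of "3 * length (enc_fmla (Count c n x \<phi>))"]
  show ?case by simp
next
  case (Dia e \<phi>)
  let ?w = "LDia # enc_stexp e"
  have "reach (length ?w) (conf 0 xs (?w @ enc_fmla \<phi> @ r) u)
      (conf 0 (xs @ ?w) (enc_fmla \<phi> @ r) (u @ ?w))"
    by (rule reach_copy_outside) (simp add: LPred_notin)
  from reach_mono[OF reach_trans[OF this Dia.IH], of "3 * length (enc_fmla (Dia e \<phi>))"]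
  show ?case by simp
qed

section \<open>Linear time bound and conclusion\<close>

lemma polytime_elim_nullary: "polytime_computable enc_fmla enc_fmla elim_nullary"
proof -
  \<comment> \<open>Three steps per letter, and one more to halt at the end of the input.\<close>
  let ?b = "[:1, 3:] :: nat poly"
  have "\<exists>t \<le> poly ?b (length (enc_fmla \<phi>)).
      halts_with elim_tm ((step elim_tm ^^ t) (init_config elim_tm (enc_fmla \<phi>)))
        (enc_fmla (elim_nullary \<phi>))" for \<phi>
  proof -
    let ?w = "enc_fmla \<phi>" and ?u = "enc_fmla (elim_nullary \<phi>)"
    let ?d = "(8, [(word_on_tape ?w, int (length ?w)),
      (word_on_tape ?u, int (length ?u) + 1)]) :: letter config"
    have "(\<lambda>_. None) = word_on_tape []" by (auto simp: word_on_tape_def)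
    then have init: "init_config elim_tm ?w = conf 0 [] (?w @ []) []"
      by (simp add: init_config_def conf_def elim_tm_def)
    have "reach (3 * length ?w) (conf 0 [] (?w @ []) []) (conf 0 ?w [] ?u)"
      using reach_enc_fmla[of \<phi> "[]" "[]" "[]"] by simp
    from reach_trans[OF this step_halt] obtain t where
      "t \<le> 3 * length ?w + 1" "(step elim_tm ^^ t) (init_config elim_tm ?w) = ?d"
      unfolding reach_def init by blast
    moreover have "halts_with elim_tm ?d ?u" by (simp add: halts_with_def elim_tm_def)
    ultimately show ?thesis by (intro exI[of _ t]) simp
  qed
  with wf_elim_tm show ?thesis unfolding polytime_computable_def by blast
qed

theorem theorem2:
  shows "\<exists>NF :: fmla \<Rightarrow> fmla.
    polytime_computable enc_fmla enc_fmla NF \<and>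
    (\<forall>\<phi>. nullary_free (NF \<phi>) \<and>
         equisatisfiable \<phi> (NF \<phi>) \<and>
         (is_C2 \<phi> \<longrightarrow> is_C2 (NF \<phi>)) \<and>
         (is_S5 \<phi> \<longrightarrow> is_S5 (NF \<phi>)) \<and>
         (monodic \<phi> \<longrightarrow> monodic (NF \<phi>)))"
proof (intro exI conjI allI impI)
  show "polytime_computable enc_fmla enc_fmla elim_nullary"
    by (rule polytime_elim_nullary)
  show "equisatisfiable \<phi> (elim_nullary \<phi>)" for \<phi>
    unfolding equisatisfiable_def
    using satisfiable_elim_nullary satisfiable_of_elim_nullary by blast
qed (fact nullary_free_elim_nullary is_C2_elim_nullary is_S5_elim_nullary
  monodic_elim_nullary)+

end
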